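(* Let $n\ge 2$ be an integer and let $z\in\mathbb{C}$ with $|z|>1$. Let $F_z=\{\sum_{i<0}a_iz^i : a_i\in\{0,\dots,n-1\}\}$. If the numeral system $(n,z)$ is proper, then $$\mu_2(F_z)>0,\qquad \mu_2\big(F_z\cap(F_z+1)\big)=0,\qquad n=|z|^2,$$ where $\mu_2$ is two-dimensional Lebesgue measure on $\mathbb{C}$.
   Context: Let $\bar n=\{0,1,\dots,n-1\}$ be the set of digits. In the definition of $F_z$, the index $i$ runs over all negative integers. A representation of $x\in\mathbb{C}$ in the system $(n,z)$ is a two-sided sequence $(a_i)_{i\in\mathbb{Z}}$ with $a_i\in\bar n$ for all $i$, with $a_i=0$ for all sufficiently large $i$, and with $\sum_{i\in\mathbb{Z}}a_iz^i=x$. The system $(n,z)$ is called proper if every $x\in\mathbb{C}$ has at least one representation, and there is a set $S\subset\mathbb{C}$ with $\mu_2(S)=0$ such that every $x\in\mathbb{C}\setminus S$ has at most one representation. *)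

theory Defs
  imports "HOL-Analysis.Analysis"
begin

definition digits :: "nat \<Rightarrow> nat set" where
  "digits n = {0..<n}"

text \<open>Sums over integer indices are unordered sums. For \<open>norm z > 1\<close> all series below converge
  absolutely, so the order of summation is immaterial.\<close>

definition represents :: "nat \<Rightarrow> complex \<Rightarrow> (int \<Rightarrow> nat) \<Rightarrow> complex \<Rightarrow> bool" where
  "represents n z a x \<longleftrightarrow>
     (\<forall>i. a i \<in> digits n) \<and>
     (\<exists>N. \<forall>i\<ge>N. a i = 0) \<and>
     ((\<lambda>i. of_nat (a i) * z powi i) has_sum x) UNIV"

definition proper :: "nat \<Rightarrow> complex \<Rightarrow> bool" where
  "proper n z \<longleftrightarrow>
     (\<forall>x. \<exists>a. represents n z a x) \<and>
     (\<exists>S \<in> null_sets lebesgue. \<forall>x. x \<notin> S \<longrightarrow>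
        (\<forall>a b. represents n z a x \<and> represents n z b x \<longrightarrow> a = b))"

definition fractions :: "nat \<Rightarrow> complex \<Rightarrow> complex set" where
  "fractions n z = {x. \<exists>a :: int \<Rightarrow> nat. (\<forall>i<0. a i \<in> digits n) \<and>
     ((\<lambda>i. of_nat (a i) * z powi i) has_sum x) {..<0}}"

end

theory Submission
  imports Defs
begin

text \<open>
  Since \<open>z F = (\<Union>d<n. F + d)\<close> and multiplication by \<open>z\<close> scales area by \<open>\<bar>z\<bar>\<^sup>2\<close>, it suffices
  that \<open>F\<close> has positive finite measure and that the translates overlap in null sets. \<open>F\<close> is compact,
  being a continuous image of a product of finite sets. If it were null, so would be
  \<open>\<complex> = (\<Union>k. z\<^sup>k F)\<close>. A point of \<open>(F + d) \<inter> (F + e)\<close> with \<open>d \<noteq> e\<close> has two representations,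
  with digits \<open>d\<close> and \<open>e\<close> at index \<open>0\<close>.
\<close>

section \<open>Area under complex multiplication\<close>

text \<open>Boxes determine the measure, and the preimage of a box is a box with the same side
  lengths. This lets the determinant formula over \<open>real^2\<close> be used for areas in
  \<open>complex\<close>.\<close>

lemma lborel_complex_eq_distr:
  "lborel = distr lborel borel (\<lambda>v::real^2. Complex (v $ 1) (v $ 2))"
proof (rule lborel_eqI)
  let ?T = "\<lambda>v::real^2. Complex (v $ 1) (v $ 2)"
  have T: "?T \<in> borel \<rightarrow>\<^sub>M borel"
    unfolding complex_eq by (intro borel_measurable_continuous_onI continuous_intros)
  fix l u :: complex
  assume le: "\<And>b. b \<in> Basis \<Longrightarrow> l \<bullet> b \<le> u \<bullet> b"
  let ?l = "vector [Re l, Im l] :: real^2" and ?u = "vector [Re u, Im u] :: real^2"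
  have "?T -` box l u = box ?l ?u"
    by (auto simp: in_box_complex_iff mem_box_cart forall_2)
  moreover have "emeasure lborel (box ?l ?u) = ennreal (\<Prod>b\<in>Basis. (?u - ?l) \<bullet> b)"
    using le[of 1] le[of \<i>] by (intro emeasure_lborel_box)
      (auto simp: Basis_vec_def Basis_complex_def inner_axis UNIV_2 inner_complex_def)
  moreover have "(\<Prod>b\<in>Basis. (?u - ?l) \<bullet> b) = (\<Prod>b\<in>Basis. (u - l) \<bullet> b)"
    by (simp add: Basis_vec_def Basis_complex_def UNION_singleton_eq_range prod.reindex axis_eq_axis inj_on_def inner_axis UNIV_2)
  ultimately show "emeasure (distr lborel borel ?T) (box l u) = (\<Prod>b\<in>Basis. (u - l) \<bullet> b)"
    using T by (simp add: emeasure_distr)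
qed simp

lemma measure_complex_mult_image:
  fixes z :: complex
  assumes "S \<in> lmeasurable"
  shows "(*) z ` S \<in> lmeasurable"
    and "measure lebesgue ((*) z ` S) = (norm z)\<^sup>2 * measure lebesgue S"
proof -
  define T where "T = (\<lambda>v::real^2. Complex (v $ 1) (v $ 2))"
  define U where "U = (\<lambda>w. vector [Re w, Im w] :: real^2)"
  have T: "T \<in> borel \<rightarrow>\<^sub>M borel"
    unfolding complex_eq T_def by (intro borel_measurable_continuous_onI continuous_intros)
  have UT: "U (T v) = v" and TU: "T (U w) = w" for v w
    by (simp_all add: vec_eq_iff forall_2 U_def T_def)
  have U: "linear U"
    by (rule linearI) (simp_all add: vec_eq_iff forall_2 U_def)
  have f: "linear (\<lambda>v. U (z * T v))"
    by (rule linearI) (simp_all add: vec_eq_iff forall_2 algebra_simps U_def T_def)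
  \<comment> \<open>For z = x + iy the matrix has rows (x, -y) and (y, x), hence determinant x^2 +
    y^2.\<close>
  have det: "\<bar>det (matrix (\<lambda>v. U (z * T v)))\<bar> = (norm z)\<^sup>2"
    by (simp add: det_2 matrix_def axis_def cmod_power2 U_def T_def flip: power2_eq_square)
  have compact_U: "compact (U ` K)" if "compact K" for K
    using that U by (intro compact_continuous_image linear_continuous_on) (simp_all add: linear_linear)
  \<comment> \<open>Compact sets and their images under \<open>U\<close> are Borel, so
    \<open>lebesgue\<close> and \<open>lborel\<close> agree on them. This case is enough below: only
    boxes and their images under multiplication by \<open>z\<close> occur.\<close>
  have transfer: "measure lebesgue (U ` K) = measure lebesgue K" if "compact K" for K
  proof -
    have vim: "T -` K = U ` K"
    proof (intro equalityI subsetI)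
      show "v \<in> U ` K" if "v \<in> T -` K" for v
        using that image_eqI[of v U "T v" K] by (simp add: UT)
    qed (auto simp: TU)
    have "measure lebesgue (U ` K) = measure lborel (T -` K)"
      using compact_U[OF that] by (simp add: vim borel_compact)
    also have "\<dots> = measure (distr lborel borel T) K"
      using that T by (simp add: measure_distr borel_compact)
    also have "\<dots> = measure lebesgue K"
      unfolding T_def lborel_complex_eq_distr[symmetric] using that by (simp add: borel_compact)
    finally show ?thesis .
  qed
  have "(*) z ` S \<in> lmeasurable \<and> (norm z)\<^sup>2 * measure lebesgue S = measure lebesgue ((*) z ` S)"
  \<comment> \<open>For a linear map, a scaling factor that is right on boxes is right on every
    measurable set.\<close>
  proof (rule measure_linear_sufficient)
    show "linear ((*) z)"
      by (rule linearI) (simp_all add: algebra_simps)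
    fix a b :: complex
    have "measure lebesgue ((*) z ` cbox a b) = measure lebesgue (U ` (*) z ` cbox a b)"
      by (intro transfer[symmetric] compact_continuous_image continuous_intros compact_cbox)
    also have "U ` (*) z ` cbox a b = (\<lambda>v. U (z * T v)) ` U ` cbox a b"
      by (simp add: image_image TU)
    also have "measure lebesgue \<dots> = (norm z)\<^sup>2 * measure lebesgue (U ` cbox a b)"
      using f by (simp add: measure_linear_image det lmeasurable_compact compact_U)
    finally show "measure lebesgue ((*) z ` cbox a b) = (norm z)\<^sup>2 * measure lebesgue (cbox a b)"
      using transfer[of "cbox a b"] by simp
  qed (fact assms)
  then show "(*) z ` S \<in> lmeasurable"
    and "measure lebesgue ((*) z ` S) = (norm z)\<^sup>2 * measure lebesgue S"
    by simp_all
qed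

section \<open>Digit sequences and the set of fractions\<close>

text \<open>Index \<open>k\<close> stands for position -k-1. Digit sequences thus become points of a
  product space over \<open>nat\<close>, and the unordered sum becomes an ordinary series.\<close>

definition fraction_value :: "complex \<Rightarrow> (nat \<Rightarrow> nat) \<Rightarrow> complex" where
  "fraction_value z c = (\<Sum>k. of_nat (c k) * inverse z ^ Suc k)"

text \<open>The bound does not depend on \<open>c\<close>: it serves for absolute convergence and,
  as a Weierstrass majorant, for continuity in \<open>c\<close>.\<close>

lemma norm_fraction_term_le:
  assumes "c \<in> UNIV \<rightarrow> digits n"
  shows "norm (of_nat (c k) * inverse z ^ Suc k :: complex) \<le> real n * inverse (norm z) ^ Suc k"
proof -
  have "c k < n"
    using assms by (auto simp: digits_def)
  then show ?thesis
    by (simp only: norm_mult norm_power norm_inverse norm_of_nat) (intro mult_right_mono, auto)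
qed

lemma summable_fraction_bound:
  fixes z :: complex
  assumes "norm z > 1"
  shows "summable (\<lambda>k. real n * inverse (norm z) ^ Suc k)"
  unfolding power_Suc using assms
  by (intro summable_mult summable_geometric) (simp add: norm_inverse inverse_less_1_iff)

lemma summable_norm_fraction:
  assumes "norm z > 1" "c \<in> UNIV \<rightarrow> digits n"
  shows "summable (\<lambda>k. norm (of_nat (c k) * inverse z ^ Suc k :: complex))"
  by (rule summable_comparison_test'[OF summable_fraction_bound[OF assms(1), of n]],
      unfold real_norm_def abs_norm_cancel) (rule norm_fraction_term_le[OF assms(2)])

lemmas summable_fraction = summable_norm_cancel[OF summable_norm_fraction]

lemma fractions_eq_image:
  assumes z: "norm z > 1"
  shows "fractions n z = fraction_value z ` (UNIV \<rightarrow> digits n)"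
proof -
  define h where "h k = - int k - 1" for k
  have range_h: "{..<0} = range h"
    by (force simp: h_def image_iff intro: exI[of _ "nat (- x - 1)" for x])
  have inj_h: "inj h"
    by (auto simp: h_def inj_on_def)
  have powi_h: "z powi h k = inverse z ^ Suc k" for k
    by (simp add: h_def power_int_def nat_add_distrib)
  have hs: "((\<lambda>i. of_nat (a i) * z powi i) has_sum x) {..<0} \<longleftrightarrow>
      ((\<lambda>k. of_nat (a (h k)) * inverse z ^ Suc k) has_sum x) UNIV" for a x
    unfolding range_h has_sum_reindex[OF inj_h] by (simp only: o_def powi_h)
  have has_sum_value: "((\<lambda>k. of_nat (c k) * inverse z ^ Suc k) has_sum fraction_value z c) UNIV"
    if "c \<in> UNIV \<rightarrow> digits n" for c
    unfolding fraction_value_def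
    using summable_norm_fraction[OF z that]
    by (intro norm_summable_imp_has_sum summable_sums) (auto dest: summable_norm_cancel)
  show ?thesis
  proof (intro equalityI subsetI)
    fix x assume "x \<in> fractions n z"
    then obtain a where a: "\<forall>i<0. a i \<in> digits n"
      and x: "((\<lambda>k. of_nat (a (h k)) * inverse z ^ Suc k) has_sum x) UNIV"
      unfolding fractions_def hs by auto
    have ah: "(\<lambda>k. a (h k)) \<in> UNIV \<rightarrow> digits n"
      using a by (auto simp: h_def)
    then show "x \<in> fraction_value z ` (UNIV \<rightarrow> digits n)"
      using has_sum_unique[OF x has_sum_value[OF ah]] by blast
  next
    fix x assume "x \<in> fraction_value z ` (UNIV \<rightarrow> digits n)"
    then obtain c where c: "c \<in> UNIV \<rightarrow> digits n" and x: "x = fraction_value z c"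
      by blast
    \<comment> \<open>The map i to -i-1 is its own inverse, so it also turns \<open>c\<close> back
      into digits at negative positions.\<close>
    have "(\<lambda>k. c (nat (- h k - 1))) = c"
      by (simp add: h_def)
    then have "((\<lambda>k. of_nat (c (nat (- h k - 1))) * inverse z ^ Suc k) has_sum x) UNIV"
      using has_sum_value[OF c] x by (simp add: h_def)
    then have "((\<lambda>i. of_nat (c (nat (- i - 1))) * z powi i) has_sum x) {..<0}"
      by (simp only: hs)
    then show "x \<in> fractions n z"
      unfolding fractions_def using c by (intro CollectI exI[of _ "\<lambda>i. c (nat (- i - 1))"]) auto
  qed
qed

text \<open>Tychonoff's theorem makes the space of digit sequences compact. Partial sums are
  continuous, since they depend on finitely many coordinates, and they converge uniformly to
  \<open>fraction_value z\<close>.\<close>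

lemma compact_fractions:
  assumes z: "norm z > 1"
  shows "compact (fractions n z)"
  unfolding fractions_eq_image[OF z]
proof (rule compact_continuous_image)
  have "compactin (product_topology (\<lambda>_::nat. euclidean) UNIV) (UNIV \<rightarrow>\<^sub>E digits n)"
    by (simp add: compactin_PiE digits_def finite_imp_compact)
  then show "compact (UNIV \<rightarrow> digits n :: (nat \<Rightarrow> nat) set)"
    by (simp add: euclidean_product_topology PiE_UNIV_domain Pi_def)
  show "continuous_on (UNIV \<rightarrow> digits n) (fraction_value z)"
  proof (rule uniform_limit_theorem)
    show "uniform_limit (UNIV \<rightarrow> digits n)
        (\<lambda>m c. \<Sum>k<m. of_nat (c k) * inverse z ^ Suc k) (fraction_value z) sequentially"
      unfolding fraction_value_def[abs_def]
      by (rule Weierstrass_m_test[OF norm_fraction_term_le summable_fraction_bound[OF z]])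
    have cont: "continuous_on (UNIV \<rightarrow> digits n) (\<lambda>c. of_nat (c k) :: complex)" for k
      by (intro continuous_on_of_nat continuous_on_subset[OF continuous_on_product_coordinates]) simp
    show "\<forall>\<^sub>F m in sequentially. continuous_on (UNIV \<rightarrow> digits n)
        (\<lambda>c. \<Sum>k<m. of_nat (c k) * inverse z ^ Suc k)"
      by (intro always_eventually allI continuous_on_sum continuous_on_mult continuous_on_const cont)
  qed simp
qed

text \<open>Multiplication by \<open>z\<close> moves the digit at position -1 to the units place and
  leaves a fraction formed by the remaining digits.\<close>

lemma mult_fractions_eq_Union:
  assumes z: "norm z > 1"
  shows "(*) z ` fractions n z = (\<Union>d\<in>digits n. (+) (of_nat d) ` fractions n z)"
proof -
  have shift: "z * fraction_value z c = of_nat (c 0) + fraction_value z (\<lambda>k. c (Suc k))"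
    if "c \<in> UNIV \<rightarrow> digits n" for c
  proof -
    have "z * fraction_value z c = (\<Sum>k. z * (of_nat (c k) * inverse z ^ Suc k))"
      unfolding fraction_value_def
      by (rule suminf_mult[symmetric, OF summable_fraction[OF z that]])
    also have "(\<lambda>k. z * (of_nat (c k) * inverse z ^ Suc k)) = (\<lambda>k. of_nat (c k) * inverse z ^ k)"
      using z by (intro ext) (auto simp: field_simps)
    also have "(\<Sum>k. of_nat (c k) * inverse z ^ k) = of_nat (c 0) + fraction_value z (\<lambda>k. c (Suc k))"
    proof -
      have "summable (\<lambda>k. of_nat (c (Suc k)) * inverse z ^ Suc k)"
        using that by (intro summable_fraction[OF z, where n = n]) auto
      then have "summable (\<lambda>k. of_nat (c k) * inverse z ^ k)"
        by (rule summable_Suc_iff[THEN iffD1])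
      from suminf_split_head[OF this] show ?thesis
        by (simp add: fraction_value_def)
    qed
    finally show ?thesis .
  qed
  show ?thesis
    unfolding fractions_eq_image[OF z]
  proof (intro equalityI subsetI)
    fix x assume "x \<in> (*) z ` fraction_value z ` (UNIV \<rightarrow> digits n)"
    then obtain c where "c \<in> UNIV \<rightarrow> digits n" "x = z * fraction_value z c"
      by blast
    then show "x \<in> (\<Union>d\<in>digits n. (+) (of_nat d) ` fraction_value z ` (UNIV \<rightarrow> digits n))"
      by (auto simp: shift intro!: bexI[of _ "c 0"] imageI)
  next
    fix x assume "x \<in> (\<Union>d\<in>digits n. (+) (of_nat d) ` fraction_value z ` (UNIV \<rightarrow> digits n))"
    then obtain d c where "d \<in> digits n" "c \<in> UNIV \<rightarrow> digits n" "x = of_nat d + fraction_value z c"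
      by blast
    \<comment> \<open>Conversely, \<open>d\<close> is put in front of \<open>c\<close>, at position
      -1, from where multiplication by \<open>z\<close> carries it to position 0.\<close>
    then have "case_nat d c \<in> UNIV \<rightarrow> digits n" "x = z * fraction_value z (case_nat d c)"
      using shift[of "case_nat d c"] by (auto simp: Pi_iff split: nat.split)
    then show "x \<in> (*) z ` fraction_value z ` (UNIV \<rightarrow> digits n)"
      by blast
  qed
qed

section \<open>From fractions to representations and back\<close>

text \<open>The conjunct \<open>a 0 = d\<close> is what later tells apart representations built from
  different digits.\<close>

lemma represents_add_digit:
  assumes "x \<in> fractions n z" "d \<in> digits n"
  shows "\<exists>a. represents n z a (of_nat d + x) \<and> a 0 = d"
proof -
  obtain a where a: "\<forall>i<0. a i \<in> digits n"
    and x: "((\<lambda>i. of_nat (a i) * z powi i) has_sum x) {..<0}"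
    using assms(1) by (auto simp: fractions_def)
  \<comment> \<open>Membership in \<open>fractions\<close> says nothing about \<open>a\<close> at
    nonnegative positions, so these are overwritten.\<close>
  define b where "b i = (if i < 0 then a i else if i = 0 then d else 0)" for i :: int
  have "((\<lambda>i. of_nat (b i) * z powi i) has_sum x) {..<0}"
    using x by (rule has_sum_cong[THEN iffD1, rotated]) (simp add: b_def)
  then have "((\<lambda>i. of_nat (b i) * z powi i) has_sum of_nat d + x) (insert 0 {..<0})"
    using has_sum_insert[of 0 "{..<0}" "\<lambda>i. of_nat (b i) * z powi i" x] by (simp add: b_def)
  then have "((\<lambda>i. of_nat (b i) * z powi i) has_sum of_nat d + x) UNIV"
    by (rule has_sum_cong_neutral[THEN iffD1, rotated -1]) (auto simp: b_def)
  \<comment> \<open>That \<open>d\<close> is a digit gives \<open>0 < n\<close>, so the padding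
    zeros are digits too.\<close>
  moreover have "\<forall>i. b i \<in> digits n"
    using a assms(2) by (auto simp: b_def digits_def)
  moreover have "\<forall>i\<ge>1. b i = 0" "b 0 = d"
    by (auto simp: b_def)
  ultimately show ?thesis
    unfolding represents_def by blast
qed

text \<open>Division by a large power of \<open>z\<close> shifts all nonzero digits to negative
  positions.\<close>

lemma represents_imp_in_mult_fractions:
  assumes "represents n z a x" "z \<noteq> 0"
  shows "\<exists>k::nat. x \<in> (*) (z ^ k) ` fractions n z"
proof -
  obtain N where a: "\<forall>i. a i \<in> digits n" and N: "\<forall>i\<ge>N. a i = 0"
    and x: "((\<lambda>i. of_nat (a i) * z powi i) has_sum x) UNIV"
    using assms(1) by (auto simp: represents_def)
  \<comment> \<open>\<open>N\<close> may be negative; in every case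
    \<open>int k \<ge> N\<close>.\<close>
  define k where "k = nat N"
  define h where "h i = i + int k" for i
  have range_h: "{..<int k} = h ` {..<0}"
    by (force simp: h_def image_iff intro: bexI[of _ "x - int k" for x])
  have inj_h: "inj_on h {..<0}"
    by (auto simp: h_def inj_on_def)
  have "a i = 0" if "i \<ge> int k" for i
    using that by (intro N[rule_format]) (auto simp: k_def split: if_splits)
  then have "((\<lambda>i. of_nat (a i) * z powi i) has_sum x) {..<int k}"
    using x by - (rule has_sum_cong_neutral[THEN iffD1, rotated -1], auto)
  then have "((\<lambda>i. of_nat (a (h i)) * z powi (h i)) has_sum x) {..<0}"
    unfolding range_h has_sum_reindex[OF inj_h] by (simp only: o_def)
  then have "((\<lambda>i. inverse (z ^ k) * (of_nat (a (h i)) * z powi (h i))) has_sum inverse (z ^ k) * x) {..<0}"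
    by (rule has_sum_cmult_right)
  also have "(\<lambda>i. inverse (z ^ k) * (of_nat (a (h i)) * z powi (h i))) = (\<lambda>i. of_nat (a (h i)) * z powi i)"
    using assms(2) by (simp add: h_def power_int_add field_simps)
  finally have "inverse (z ^ k) * x \<in> fractions n z"
    unfolding fractions_def using a by (auto intro!: exI[of _ "\<lambda>i. a (h i)"])
  then show ?thesis
    using assms(2) by (auto simp: image_iff field_simps intro!: exI[of _ k] bexI)
qed

section \<open>Positive area, null overlaps and the value of n\<close>

theorem lemma2:
  fixes n :: nat and z :: complex
  assumes "n \<ge> 2" and "norm z > 1" and "proper n z"
  shows "emeasure lebesgue (fractions n z) > 0
    \<and> fractions n z \<inter> (\<lambda>x. x + 1) ` fractions n z \<in> null_sets lebesgue
    \<and> real n = (norm z)\<^sup>2"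
proof -
  let ?F = "fractions n z"
  obtain S where S: "S \<in> null_sets lebesgue"
    and unique: "\<And>x a b. x \<notin> S \<Longrightarrow> represents n z a x \<Longrightarrow> represents n z b x \<Longrightarrow> a = b"
    using assms(3) unfolding proper_def by blast
  have F: "?F \<in> lmeasurable"
    using compact_fractions[OF assms(2)] by (rule lmeasurable_compact)
  have overlap: "(+) (of_nat d) ` ?F \<inter> (+) (of_nat e) ` ?F \<subseteq> S"
    if "d \<in> digits n" "e \<in> digits n" "d \<noteq> e" for d e
    using represents_add_digit that unique by (smt (verit, best) IntE imageE subsetI)
  have "?F \<notin> null_sets lebesgue"
  proof
    assume null: "?F \<in> null_sets lebesgue"
    have "(*) (z ^ k) ` ?F \<in> null_sets lebesgue" for k
      using measure_complex_mult_image[OF F, of "z ^ k"] null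
      by (simp add: negligible_iff_measure flip: negligible_iff_null_sets)
    then have "(\<Union>k. (*) (z ^ k) ` ?F) \<in> null_sets lebesgue"
      by blast
    \<comment> \<open>This is the existence half of \<open>proper\<close>.\<close>
    moreover have "(\<Union>k. (*) (z ^ k) ` ?F) = UNIV"
      using assms represents_imp_in_mult_fractions[of n z] unfolding proper_def by fastforce
    ultimately show False
      by (simp add: null_sets_def)
  qed
  then have pos: "emeasure lebesgue ?F > 0"
    using F by (auto simp: null_sets_def zero_less_iff_neq_zero)
  have "(norm z)\<^sup>2 * measure lebesgue ?F = measure lebesgue (\<Union>d\<in>digits n. (+) (of_nat d) ` ?F)"
    using measure_complex_mult_image(2)[OF F, of z] mult_fractions_eq_Union[OF assms(2)] by simp
  also have "\<dots> = (\<Sum>d\<in>digits n. measure lebesgue ((+) (of_nat d) ` ?F))"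
  \<comment> \<open>Additivity needs the translates to be disjoint only almost everywhere;
    \<open>S\<close> contains every overlap.\<close>
  proof (rule measure_UNION_AE)
    show "pairwise (\<lambda>d e. AE x in lebesgue. x \<notin> (+) (of_nat d) ` ?F \<or> x \<notin> (+) (of_nat e) ` ?F) (digits n)"
      using overlap by (intro pairwiseI AE_I'[OF S]) blast
  qed (use F measurable_translation in \<open>auto simp: digits_def\<close>)
  also have "\<dots> = real n * measure lebesgue ?F"
    by (simp add: measure_translation digits_def)
  \<comment> \<open>The factor \<open>measure lebesgue ?F\<close> cancels: it is nonzero because the
    area of \<open>?F\<close> is both positive and finite.\<close>
  finally have "(norm z)\<^sup>2 = real n"
    using pos F by (auto simp: measure_def fmeasurable_def enn2real_eq_0_iff)
  moreover have "?F \<inter> (\<lambda>x. x + 1) ` ?F \<in> null_sets lebesgue"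
  proof (rule null_sets_completion_subset[OF _ S])
    show "?F \<inter> (\<lambda>x. x + 1) ` ?F \<subseteq> S"
      \<comment> \<open>Since \<open>n \<ge> 2\<close>, both 0 and 1 are digits.\<close>
      using overlap[of 0 1] assms(1) by (simp add: digits_def add.commute)
  qed
  ultimately show ?thesis
    using pos by simp
qed

end
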